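(* Let $p$ be a prime number. The following conditions are equivalent for every function $f \colon \mathbb{R}^{+} \to \mathbb{R}^{+}$: (i) $f(0) = 0$ and the double inequality $0 < f(p^{n}) \leq f(p^{n+1})$ holds for every $n \in \mathbb{Z}$. (ii) The function $f$ is $p$-adic ultrametric preserving.
   Context: $\mathbb{R}^{+}$ denotes the set of all non-negative real numbers. For a prime $p$, $|\cdot|_p$ is the $p$-adic absolute value on the field $\mathbb{Q}_p$ of $p$-adic numbers, normalized so that $|0|_p = 0$ and $|x|_p = p^{-\operatorname{ord}_p x}$ for $x \neq 0$, and $d_p(x,y) = |x-y|_p$ is the $p$-adic metric on $\mathbb{Q}_p$. An ultrametric is a metric $d$ satisfying $d(x,y) \leq \max\{d(x,z), d(z,y)\}$ for all $x,y,z$. A function $f \colon \mathbb{R}^{+} \to \mathbb{R}^{+}$ is called $p$-adic ultrametric preserving if the composition $f \circ d_p$ is an ultrametric on $\mathbb{Q}_p$. *)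

theory Defs
  imports
    "HOL-Computational_Algebra.Primes"
    "HOL-Algebra.QuotRing"
    "HOL-Analysis.Abstract_Metric_Spaces"
begin

section \<open>The \<open>p\<close>-adic absolute value on the rationals\<close>

text \<open>At \<open>0\<close> the value of the order is junk; it is never used there.\<close>

definition padic_ord_rat :: "nat \<Rightarrow> rat \<Rightarrow> int" where
  "padic_ord_rat p q =
     int (multiplicity (int p) (fst (quotient_of q))) -
     int (multiplicity (int p) (snd (quotient_of q)))"

definition padic_abs_rat :: "nat \<Rightarrow> rat \<Rightarrow> real" where
  "padic_abs_rat p q = (if q = 0 then 0 else real p powi (- padic_ord_rat p q))"


section \<open>The field of \<open>p\<close>-adic numbers\<close>

text \<open>
  The field is the completion of the rationals for the \<open>p\<close>-adic absolute value, built as the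
  quotient of the ring of \<open>p\<close>-adic Cauchy sequences of rationals by the ideal of null sequences.
  Its elements are therefore sets of sequences.
\<close>

definition padic_cauchy :: "nat \<Rightarrow> (nat \<Rightarrow> rat) \<Rightarrow> bool" where
  "padic_cauchy p x \<longleftrightarrow>
     (\<forall>e>0. \<exists>N. \<forall>m\<ge>N. \<forall>n\<ge>N. padic_abs_rat p (x m - x n) < e)"

definition padic_cauchy_ring :: "nat \<Rightarrow> (nat \<Rightarrow> rat) ring" where
  "padic_cauchy_ring p =
     \<lparr>carrier = {x. padic_cauchy p x},
      mult = (\<lambda>x y n. x n * y n), one = (\<lambda>n. 1),
      zero = (\<lambda>n. 0), add = (\<lambda>x y n. x n + y n)\<rparr>"

definition padic_null :: "nat \<Rightarrow> (nat \<Rightarrow> rat) set" where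
  "padic_null p = {x. (\<lambda>n. padic_abs_rat p (x n)) \<longlonglongrightarrow> 0}"

definition padic_field :: "nat \<Rightarrow> (nat \<Rightarrow> rat) set ring" where
  "padic_field p = padic_cauchy_ring p Quot padic_null p"

text \<open>
  The order of a nonzero \<open>p\<close>-adic number is the eventually constant order of the terms of any
  sequence representing it (see \<open>padic_ord_eqI\<close> and \<open>padic_cauchy_nonnull\<close> below).
\<close>

definition padic_ord :: "nat \<Rightarrow> (nat \<Rightarrow> rat) set \<Rightarrow> int" where
  "padic_ord p X =
     (THE k. \<forall>x\<in>X. eventually (\<lambda>n. padic_ord_rat p (x n) = k) sequentially)"

definition padic_abs :: "nat \<Rightarrow> (nat \<Rightarrow> rat) set \<Rightarrow> real" where
  "padic_abs p X =
     (if X = \<zero>\<^bsub>padic_field p\<^esub> then 0 else real p powi (- padic_ord p X))"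

definition padic_dist :: "nat \<Rightarrow> (nat \<Rightarrow> rat) set \<Rightarrow> (nat \<Rightarrow> rat) set \<Rightarrow> real" where
  "padic_dist p X Y = padic_abs p (X \<ominus>\<^bsub>padic_field p\<^esub> Y)"


section \<open>Ultrametrics\<close>

text \<open>
  The locale \<^locale>\<open>Metric_space\<close> demands nonnegativity and symmetry on the whole type, so the
  function is first set to \<open>0\<close> outside of \<open>M\<close>; see \<open>ultrametric_on_iff\<close>.
\<close>

definition ultrametric_on :: "'a set \<Rightarrow> ('a \<Rightarrow> 'a \<Rightarrow> real) \<Rightarrow> bool" where
  "ultrametric_on M d \<longleftrightarrow>
     Metric_space M (\<lambda>x y. if x \<in> M \<and> y \<in> M then d x y else 0) \<and>
     (\<forall>x\<in>M. \<forall>y\<in>M. \<forall>z\<in>M. d x y \<le> max (d x z) (d z y))"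

definition padic_ultrametric_preserving :: "nat \<Rightarrow> (real \<Rightarrow> real) \<Rightarrow> bool" where
  "padic_ultrametric_preserving p f \<longleftrightarrow>
     ultrametric_on (carrier (padic_field p)) (\<lambda>x y. f (padic_dist p x y))"

lemma ultrametric_on_iff:
  "ultrametric_on M d \<longleftrightarrow>
     (\<forall>x\<in>M. \<forall>y\<in>M. 0 \<le> d x y \<and> d x y = d y x \<and> (d x y = 0 \<longleftrightarrow> x = y)) \<and>
     (\<forall>x\<in>M. \<forall>y\<in>M. \<forall>z\<in>M. d x y \<le> max (d x z) (d z y))" (is "?L \<longleftrightarrow> ?R")
proof
  assume L: ?L
  let ?d = "\<lambda>x y. if x \<in> M \<and> y \<in> M then d x y else 0"
  interpret Metric_space M ?d using L by (simp add: ultrametric_on_def)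
  have "0 \<le> d x y \<and> d x y = d y x \<and> (d x y = 0 \<longleftrightarrow> x = y)" if "x \<in> M" "y \<in> M" for x y
    using that nonneg[of x y] commute[of x y] zero[of x y] by simp
  then show ?R using L unfolding ultrametric_on_def by blast
next
  assume R: ?R
  have "d x z \<le> d x y + d y z" if "x \<in> M" "y \<in> M" "z \<in> M" for x y z
  proof -
    have "d x z \<le> max (d x y) (d y z)" "0 \<le> d x y" "0 \<le> d y z" using R that by blast+
    then show ?thesis by linarith
  qed
  moreover have "0 \<le> d x y" "d x y = d y x" "d x y = 0 \<longleftrightarrow> x = y" if "x \<in> M" "y \<in> M" for x y
    using R that by blast+
  ultimately have "Metric_space M (\<lambda>x y. if x \<in> M \<and> y \<in> M then d x y else 0)"
    by unfold_locales auto
  then show ?L using R unfolding ultrametric_on_def by blast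
qed


section \<open>Basic properties of the construction\<close>

context
  fixes p :: nat
  assumes p: "prime p"
begin

lemma p_gt1: "real p > 1"
  using p prime_gt_1_nat by simp

lemma int_p: "prime_elem (int p)"
  using p by simp

lemma padic_ord_rat_divide:
  assumes "a \<noteq> 0" "b \<noteq> 0"
  shows "padic_ord_rat p (of_int a / of_int b) =
    int (multiplicity (int p) a) - int (multiplicity (int p) b)"
proof -
  obtain c d where cd: "quotient_of (of_int a / of_int b) = (c, d)" by force
  have d: "d > 0" using quotient_of_denom_pos[OF cd] .
  have "(of_int a / of_int b :: rat) = of_int c / of_int d" using quotient_of_div[OF cd] .
  then have "(of_int (a * d) :: rat) = of_int (c * b)"
    using assms d by (simp add: field_simps)
  then have eq: "a * d = c * b" by (simp only: of_int_eq_iff)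
  then have c: "c \<noteq> 0" using assms d by auto
  have "multiplicity (int p) a + multiplicity (int p) d = multiplicity (int p) c + multiplicity (int p) b"
    using prime_elem_multiplicity_mult_distrib[OF int_p, of a d]
      prime_elem_multiplicity_mult_distrib[OF int_p, of c b] assms c d eq by simp
  then show ?thesis unfolding padic_ord_rat_def cd by simp
qed

lemma rat_as_fraction:
  obtains a b :: int where "(q::rat) = of_int a / of_int b" "b \<noteq> 0"
proof -
  obtain c d where cd: "quotient_of q = (c, d)" by force
  show ?thesis using that[of c d] quotient_of_div[OF cd] quotient_of_denom_pos[OF cd] by simp
qed

lemma padic_ord_rat_mult:
  assumes "q \<noteq> 0" "r \<noteq> 0"
  shows "padic_ord_rat p (q * r) = padic_ord_rat p q + padic_ord_rat p r"
proof -
  obtain a b where ab: "q = of_int a / of_int b" "b \<noteq> 0" by (rule rat_as_fraction)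
  obtain c d where cd: "r = of_int c / of_int d" "d \<noteq> 0" by (rule rat_as_fraction)
  have nz: "a \<noteq> 0" "c \<noteq> 0" using ab cd assms by auto
  have "q * r = of_int (a * c) / of_int (b * d)" using ab cd by simp
  then show ?thesis
    using padic_ord_rat_divide[of "a * c" "b * d"] padic_ord_rat_divide[of a b]
      padic_ord_rat_divide[of c d] ab cd nz
    by (simp add: prime_elem_multiplicity_mult_distrib[OF int_p])
qed

lemma padic_ord_rat_add:
  assumes "q \<noteq> 0" "r \<noteq> 0" "q + r \<noteq> 0"
  shows "min (padic_ord_rat p q) (padic_ord_rat p r) \<le> padic_ord_rat p (q + r)"
proof -
  obtain a b where ab: "q = of_int a / of_int b" "b \<noteq> 0" by (rule rat_as_fraction)
  obtain c d where cd: "r = of_int c / of_int d" "d \<noteq> 0" by (rule rat_as_fraction)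
  have nz: "a \<noteq> 0" "c \<noteq> 0" using ab cd assms by auto
  have q: "q = of_int (a * d) / of_int (b * d)" using ab cd by simp
  have r: "r = of_int (b * c) / of_int (b * d)" using ab cd by simp
  have s: "q + r = of_int (a * d + b * c) / of_int (b * d)"
    unfolding q r by (simp add: add_divide_distrib)
  have nzs: "a * d + b * c \<noteq> 0" using assms s by (metis div_0 of_int_0)
  have nzd: "b * d \<noteq> 0" "a * d \<noteq> 0" "b * c \<noteq> 0" using ab cd nz by auto
  let ?m = "min (multiplicity (int p) (a * d)) (multiplicity (int p) (b * c))"
  have "int p ^ ?m dvd a * d" "int p ^ ?m dvd b * c"
    by (meson multiplicity_dvd' min.cobounded1 min.cobounded2)+
  then have "int p ^ ?m dvd a * d + b * c" by simp
  then have "?m \<le> multiplicity (int p) (a * d + b * c)"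
    using nzs int_p by (intro multiplicity_geI) (auto simp: prime_elem_def)
  then show ?thesis unfolding s unfolding q r
    using padic_ord_rat_divide[OF nzs nzd(1)] padic_ord_rat_divide[OF nzd(2,1)]
      padic_ord_rat_divide[OF nzd(3,1)] by linarith
qed

lemma padic_abs_rat_nonneg: "0 \<le> padic_abs_rat p q"
  by (simp add: padic_abs_rat_def)

lemma padic_abs_rat_0: "padic_abs_rat p 0 = 0"
  by (simp add: padic_abs_rat_def)

lemma padic_abs_rat_eq_0: "padic_abs_rat p q = 0 \<longleftrightarrow> q = 0"
  using p_gt1 by (simp add: padic_abs_rat_def)

lemma padic_abs_rat_mult: "padic_abs_rat p (q * r) = padic_abs_rat p q * padic_abs_rat p r"
proof (cases "q = 0 \<or> r = 0")
  case False
  have "real p powi (- padic_ord_rat p q + - padic_ord_rat p r) =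
    real p powi (- padic_ord_rat p q) * real p powi (- padic_ord_rat p r)"
    using p_gt1 by (intro power_int_add) auto
  then show ?thesis using False by (simp add: padic_abs_rat_def padic_ord_rat_mult)
qed (auto simp: padic_abs_rat_def)

lemma padic_abs_rat_1: "padic_abs_rat p 1 = 1"
  using padic_abs_rat_mult[of 1 1] padic_abs_rat_eq_0[of 1] by simp

lemma padic_abs_rat_minus: "padic_abs_rat p (- q) = padic_abs_rat p q"
proof -
  have "padic_abs_rat p (-1) * padic_abs_rat p (-1) = 1"
    using padic_abs_rat_mult[of "-1" "-1"] padic_abs_rat_1 by simp
  then have "padic_abs_rat p (-1) = 1"
    using padic_abs_rat_nonneg[of "-1"] by (metis abs_of_nonneg abs_mult_self_eq real_sqrt_abs2 real_sqrt_one)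
  then show ?thesis using padic_abs_rat_mult[of "-1" q] by simp
qed

lemma padic_abs_rat_diff_commute: "padic_abs_rat p (q - r) = padic_abs_rat p (r - q)"
  using padic_abs_rat_minus[of "q - r"] by simp

lemma padic_abs_rat_add: "padic_abs_rat p (q + r) \<le> max (padic_abs_rat p q) (padic_abs_rat p r)"
proof (cases "q = 0 \<or> r = 0 \<or> q + r = 0")
  case True
  then show ?thesis
    using padic_abs_rat_nonneg[of q] padic_abs_rat_nonneg[of r]
    by (auto simp: padic_abs_rat_0)
next
  case False
  then have "min (padic_ord_rat p q) (padic_ord_rat p r) \<le> padic_ord_rat p (q + r)"
    by (intro padic_ord_rat_add) auto
  then have "- padic_ord_rat p (q + r) \<le> - padic_ord_rat p q \<or>
    - padic_ord_rat p (q + r) \<le> - padic_ord_rat p r" by linarith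
  then show ?thesis using False p_gt1
    by (auto simp: padic_abs_rat_def le_max_iff_disj intro: power_int_increasing)
qed

lemma padic_abs_rat_diff: "padic_abs_rat p (q - r) \<le> max (padic_abs_rat p q) (padic_abs_rat p r)"
  using padic_abs_rat_add[of q "- r"] padic_abs_rat_minus[of r] by simp

lemma padic_abs_rat_eqI:
  assumes "padic_abs_rat p (q - r) < padic_abs_rat p r"
  shows "padic_abs_rat p q = padic_abs_rat p r"
  using padic_abs_rat_add[of "q - r" r] padic_abs_rat_diff[of q "q - r"] assms by simp

lemma padic_ord_rat_eqI:
  assumes "padic_abs_rat p (q - r) < padic_abs_rat p r"
  shows "q \<noteq> 0" "padic_ord_rat p q = padic_ord_rat p r"
proof -
  have r: "r \<noteq> 0" using assms padic_abs_rat_nonneg[of "q - r"] by (auto simp: padic_abs_rat_0)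
  have eq: "padic_abs_rat p q = padic_abs_rat p r" by (rule padic_abs_rat_eqI[OF assms])
  then show q: "q \<noteq> 0" using r padic_abs_rat_eq_0 by metis
  have "real p powi (- padic_ord_rat p q) = real p powi (- padic_ord_rat p r)"
    using eq q r by (simp add: padic_abs_rat_def)
  then show "padic_ord_rat p q = padic_ord_rat p r"
    using p_gt1 by (metis linorder_neq_iff neg_equal_iff_equal power_int_strict_increasing)
qed

lemma padic_null_iff:
  "x \<in> padic_null p \<longleftrightarrow> (\<forall>e>0. \<exists>N. \<forall>n\<ge>N. padic_abs_rat p (x n) < e)"
  unfolding padic_null_def by (simp add: lim_sequentially padic_abs_rat_nonneg)

lemma padic_null_cauchy: "x \<in> padic_null p \<Longrightarrow> padic_cauchy p x"
  unfolding padic_null_iff padic_cauchy_def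
  by (meson max_less_iff_conj order_le_less_trans padic_abs_rat_diff)

lemma padic_cauchy_bounded:
  assumes "padic_cauchy p x"
  obtains B where "B > 0" "eventually (\<lambda>n. padic_abs_rat p (x n) \<le> B) sequentially"
proof -
  obtain N where N: "\<And>m n. m \<ge> N \<Longrightarrow> n \<ge> N \<Longrightarrow> padic_abs_rat p (x m - x n) < 1"
    using assms unfolding padic_cauchy_def by (metis zero_less_one)
  let ?B = "max 1 (padic_abs_rat p (x N))"
  have "padic_abs_rat p (x n) \<le> ?B" if "n \<ge> N" for n
    using padic_abs_rat_add[of "x n - x N" "x N"] N[of n N] that by auto
  then have "eventually (\<lambda>n. padic_abs_rat p (x n) \<le> ?B) sequentially"
    by (auto simp: eventually_sequentially)
  then show ?thesis using that[of ?B] by simp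
qed

lemma padic_cauchy_const: "padic_cauchy p (\<lambda>n. c)"
  by (simp add: padic_cauchy_def padic_abs_rat_0)

lemma padic_cauchy_add:
  assumes "padic_cauchy p x" "padic_cauchy p y"
  shows "padic_cauchy p (\<lambda>n. x n + y n)"
  unfolding padic_cauchy_def
proof (intro allI impI)
  fix e :: real assume e: "e > 0"
  obtain N where N: "\<And>m n. m \<ge> N \<Longrightarrow> n \<ge> N \<Longrightarrow> padic_abs_rat p (x m - x n) < e"
    using assms e unfolding padic_cauchy_def by meson
  obtain N' where N': "\<And>m n. m \<ge> N' \<Longrightarrow> n \<ge> N' \<Longrightarrow> padic_abs_rat p (y m - y n) < e"
    using assms e unfolding padic_cauchy_def by meson
  have "padic_abs_rat p (x m + y m - (x n + y n)) < e" if "m \<ge> max N N'" "n \<ge> max N N'" for m n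
    using padic_abs_rat_add[of "x m - x n" "y m - y n"] N[of m n] N'[of m n] that
    by (simp add: algebra_simps)
  then show "\<exists>N. \<forall>m\<ge>N. \<forall>n\<ge>N. padic_abs_rat p (x m + y m - (x n + y n)) < e" by blast
qed

lemma padic_cauchy_minus: "padic_cauchy p x \<Longrightarrow> padic_cauchy p (\<lambda>n. - x n)"
  unfolding padic_cauchy_def
  by (metis minus_diff_minus padic_abs_rat_minus)

lemma padic_cauchy_mult:
  assumes "padic_cauchy p x" "padic_cauchy p y"
  shows "padic_cauchy p (\<lambda>n. x n * y n)"
  unfolding padic_cauchy_def
proof (intro allI impI)
  fix e :: real assume e: "e > 0"
  obtain B where B: "B > 0" "eventually (\<lambda>n. padic_abs_rat p (x n) \<le> B) sequentially"
    by (rule padic_cauchy_bounded[OF assms(1)])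
  obtain C where C: "C > 0" "eventually (\<lambda>n. padic_abs_rat p (y n) \<le> C) sequentially"
    by (rule padic_cauchy_bounded[OF assms(2)])
  obtain M where M: "\<And>n. n \<ge> M \<Longrightarrow> padic_abs_rat p (x n) \<le> B \<and> padic_abs_rat p (y n) \<le> C"
    using eventually_conj[OF B(2) C(2)] by (auto simp: eventually_sequentially)
  have "e / C > 0" "e / B > 0" using e B(1) C(1) by auto
  then obtain N N' where
    N: "\<And>m n. m \<ge> N \<Longrightarrow> n \<ge> N \<Longrightarrow> padic_abs_rat p (x m - x n) < e / C" and
    N': "\<And>m n. m \<ge> N' \<Longrightarrow> n \<ge> N' \<Longrightarrow> padic_abs_rat p (y m - y n) < e / B"
    using assms unfolding padic_cauchy_def by meson
  have "padic_abs_rat p (x m * y m - x n * y n) < e"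
    if "m \<ge> Max {M, N, N'}" "n \<ge> Max {M, N, N'}" for m n
  proof -
    have mn: "m \<ge> M" "m \<ge> N" "m \<ge> N'" "n \<ge> M" "n \<ge> N" "n \<ge> N'" using that by auto
    have "padic_abs_rat p (x m - x n) * padic_abs_rat p (y m) \<le> padic_abs_rat p (x m - x n) * C"
      using M[of m] mn by (intro mult_left_mono) (auto simp: padic_abs_rat_nonneg)
    also have "\<dots> < e / C * C"
      using N[of m n] mn C(1) by (intro mult_strict_right_mono) auto
    finally have "padic_abs_rat p ((x m - x n) * y m) < e"
      using C(1) by (simp add: padic_abs_rat_mult)
    moreover have "padic_abs_rat p (x n) * padic_abs_rat p (y m - y n) \<le> B * padic_abs_rat p (y m - y n)"
      using M[of n] mn by (intro mult_right_mono) (auto simp: padic_abs_rat_nonneg)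
    then have "padic_abs_rat p (x n) * padic_abs_rat p (y m - y n) < B * (e / B)"
      using N'[of m n] mn B(1)
      by (meson mult_strict_left_mono order_le_less_trans)
    then have "padic_abs_rat p (x n * (y m - y n)) < e"
      using B(1) by (simp add: padic_abs_rat_mult)
    ultimately show ?thesis
      using padic_abs_rat_add[of "(x m - x n) * y m" "x n * (y m - y n)"]
      by (simp add: algebra_simps)
  qed
  then show "\<exists>N. \<forall>m\<ge>N. \<forall>n\<ge>N. padic_abs_rat p (x m * y m - x n * y n) < e" by blast
qed

lemma padic_cauchy_nonnull:
  assumes "padic_cauchy p x" "x \<notin> padic_null p"
  obtains k where
    "eventually (\<lambda>n. x n \<noteq> 0 \<and> padic_ord_rat p (x n) = k) sequentially"
proof -
  obtain e where e: "e > 0" "\<And>N. \<exists>n\<ge>N. padic_abs_rat p (x n) \<ge> e"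
    using assms(2) unfolding padic_null_iff by (meson not_le)
  obtain N where N: "\<And>m n. m \<ge> N \<Longrightarrow> n \<ge> N \<Longrightarrow> padic_abs_rat p (x m - x n) < e"
    using assms(1) e(1) unfolding padic_cauchy_def by meson
  obtain n where n: "n \<ge> N" "padic_abs_rat p (x n) \<ge> e" using e(2) by blast
  have "x m \<noteq> 0 \<and> padic_ord_rat p (x m) = padic_ord_rat p (x n)" if "m \<ge> N" for m
    using padic_ord_rat_eqI[of "x m" "x n"] N[of m n] n that by auto
  then show ?thesis using that by (auto simp: eventually_sequentially)
qed

lemma padic_cauchy_inverse:
  assumes "padic_cauchy p x" "x \<notin> padic_null p"
  shows "padic_cauchy p (\<lambda>n. inverse (x n))"
  unfolding padic_cauchy_def
proof (intro allI impI)
  fix e :: real assume e: "e > 0"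
  obtain k where "eventually (\<lambda>n. x n \<noteq> 0 \<and> padic_ord_rat p (x n) = k) sequentially"
    by (rule padic_cauchy_nonnull[OF assms])
  then obtain M where M: "\<And>n. n \<ge> M \<Longrightarrow> x n \<noteq> 0 \<and> padic_ord_rat p (x n) = k"
    by (auto simp: eventually_sequentially)
  define c where "c = real p powi (- k)"
  have c: "c > 0" using p_gt1 by (simp add: c_def)
  have Mc: "padic_abs_rat p (x n) = c" if "n \<ge> M" for n
    using M[OF that] by (simp add: padic_abs_rat_def c_def)
  have "e * c * c > 0" using e c by simp
  then obtain N where N: "\<And>m n. m \<ge> N \<Longrightarrow> n \<ge> N \<Longrightarrow> padic_abs_rat p (x m - x n) < e * c * c"
    using assms(1) unfolding padic_cauchy_def by meson
  have "padic_abs_rat p (inverse (x m) - inverse (x n)) < e"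
    if "m \<ge> max M N" "n \<ge> max M N" for m n
  proof -
    have "(inverse (x m) - inverse (x n)) * (x m * x n) = x n - x m"
      using M[of m] M[of n] that by (simp add: field_simps)
    then have "padic_abs_rat p (inverse (x m) - inverse (x n)) * (c * c) = padic_abs_rat p (x n - x m)"
      using Mc[of m] Mc[of n] that padic_abs_rat_mult by (metis max.bounded_iff)
    also have "\<dots> < e * (c * c)" using N[of n m] that by (simp add: mult.assoc)
    finally show ?thesis using c by (metis mult_less_cancel_right_pos mult_pos_pos)
  qed
  then show "\<exists>N. \<forall>m\<ge>N. \<forall>n\<ge>N. padic_abs_rat p (inverse (x m) - inverse (x n)) < e" by blast
qed

lemma padic_cauchy_ring_cring: "cring (padic_cauchy_ring p)"
proof (rule cringI)
  show "abelian_group (padic_cauchy_ring p)"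
  proof (rule abelian_groupI)
    fix x assume "x \<in> carrier (padic_cauchy_ring p)"
    then show "\<exists>y\<in>carrier (padic_cauchy_ring p).
        y \<oplus>\<^bsub>padic_cauchy_ring p\<^esub> x = \<zero>\<^bsub>padic_cauchy_ring p\<^esub>"
      by (intro bexI[of _ "\<lambda>n. - x n"]) (auto simp: padic_cauchy_ring_def padic_cauchy_minus)
  qed (auto simp: padic_cauchy_ring_def padic_cauchy_add padic_cauchy_const algebra_simps)
  show "comm_monoid (padic_cauchy_ring p)"
    by (rule comm_monoidI)
      (auto simp: padic_cauchy_ring_def padic_cauchy_mult padic_cauchy_const algebra_simps)
qed (auto simp: padic_cauchy_ring_def algebra_simps)

lemma a_inv_padic_cauchy_ring:
  assumes "padic_cauchy p x"
  shows "\<ominus>\<^bsub>padic_cauchy_ring p\<^esub> x = (\<lambda>n. - x n)"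
proof -
  interpret cring "padic_cauchy_ring p" by (rule padic_cauchy_ring_cring)
  show ?thesis
    by (rule minus_equality)
      (use assms in \<open>auto simp: padic_cauchy_ring_def padic_cauchy_minus\<close>)
qed

lemma padic_null_add:
  assumes "x \<in> padic_null p" "y \<in> padic_null p"
  shows "(\<lambda>n. x n + y n) \<in> padic_null p"
  unfolding padic_null_iff
proof (intro allI impI)
  fix e :: real assume "e > 0"
  then obtain N N' where "\<And>n. n \<ge> N \<Longrightarrow> padic_abs_rat p (x n) < e"
    "\<And>n. n \<ge> N' \<Longrightarrow> padic_abs_rat p (y n) < e"
    using assms unfolding padic_null_iff by meson
  then have "padic_abs_rat p (x n + y n) < e" if "n \<ge> max N N'" for n
    using padic_abs_rat_add[of "x n" "y n"] that by (meson max.bounded_iff max_less_iff_conj order_le_less_trans)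
  then show "\<exists>N. \<forall>n\<ge>N. padic_abs_rat p (x n + y n) < e" by blast
qed

lemma padic_null_minus: "x \<in> padic_null p \<Longrightarrow> (\<lambda>n. - x n) \<in> padic_null p"
  by (simp add: padic_null_def padic_abs_rat_minus)

lemma padic_null_0: "(\<lambda>n. 0) \<in> padic_null p"
  by (simp add: padic_null_def padic_abs_rat_0)

lemma padic_null_mult:
  assumes "x \<in> padic_null p" "padic_cauchy p y"
  shows "(\<lambda>n. x n * y n) \<in> padic_null p"
proof -
  obtain B where B: "B > 0" "eventually (\<lambda>n. padic_abs_rat p (y n) \<le> B) sequentially"
    by (rule padic_cauchy_bounded[OF assms(2)])
  have "(\<lambda>n. padic_abs_rat p (x n) * B) \<longlonglongrightarrow> 0"
    using assms(1) unfolding padic_null_def by (auto intro: tendsto_mult_left_zero)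
  then have "(\<lambda>n. padic_abs_rat p (x n * y n)) \<longlonglongrightarrow> 0"
  proof (rule tendsto_sandwich[OF _ _ tendsto_const, rotated 2])
    show "eventually (\<lambda>n. 0 \<le> padic_abs_rat p (x n * y n)) sequentially"
      by (simp add: padic_abs_rat_nonneg)
    show "eventually (\<lambda>n. padic_abs_rat p (x n * y n) \<le> padic_abs_rat p (x n) * B) sequentially"
      using B(2) by eventually_elim (simp add: padic_abs_rat_mult padic_abs_rat_nonneg mult_left_mono)
  qed
  then show ?thesis by (simp add: padic_null_def)
qed

lemma padic_null_ideal: "ideal (padic_null p) (padic_cauchy_ring p)"
proof -
  interpret cring "padic_cauchy_ring p" by (rule padic_cauchy_ring_cring)
  have "a_inv (padic_cauchy_ring p) x \<in> padic_null p" if "x \<in> padic_null p" for x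
    using that by (simp add: a_inv_padic_cauchy_ring padic_null_cauchy padic_null_minus)
  then have "subgroup (padic_null p) (add_monoid (padic_cauchy_ring p))"
    by (intro subgroup.intro)
      (auto simp: padic_null_cauchy padic_null_add padic_null_0 padic_cauchy_ring_def a_inv_def)
  then show ?thesis
    by (rule idealI[OF ring_axioms])
      (auto simp: padic_cauchy_ring_def mult.commute intro: padic_null_mult dest: padic_null_mult)
qed

lemma padic_field_carrier:
  "X \<in> carrier (padic_field p) \<longleftrightarrow>
     (\<exists>x. padic_cauchy p x \<and> X = padic_null p +>\<^bsub>padic_cauchy_ring p\<^esub> x)"
proof -
  have "carrier (padic_cauchy_ring p) = {x. padic_cauchy p x}"
    by (simp add: padic_cauchy_ring_def)
  then show ?thesis by (auto simp: padic_field_def FactRing_def A_RCOSETS_def')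
qed

lemma padic_coset:
  "padic_null p +>\<^bsub>padic_cauchy_ring p\<^esub> x = {y. (\<lambda>n. y n - x n) \<in> padic_null p}"
proof -
  have "\<exists>h\<in>padic_null p. y = (\<lambda>n. h n + x n)" if "(\<lambda>n. y n - x n) \<in> padic_null p" for y
    using that by (intro bexI[of _ "\<lambda>n. y n - x n"]) auto
  then show ?thesis by (auto simp: a_r_coset_def' padic_cauchy_ring_def)
qed

lemma padic_coset_eq_0:
  assumes "padic_cauchy p x"
  shows "padic_null p +>\<^bsub>padic_cauchy_ring p\<^esub> x = \<zero>\<^bsub>padic_field p\<^esub> \<longleftrightarrow> x \<in> padic_null p"
proof
  assume "padic_null p +>\<^bsub>padic_cauchy_ring p\<^esub> x = \<zero>\<^bsub>padic_field p\<^esub>"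
  moreover have "x \<in> padic_null p +>\<^bsub>padic_cauchy_ring p\<^esub> x"
    by (simp add: padic_coset padic_null_0)
  ultimately show "x \<in> padic_null p" by (simp add: padic_field_def FactRing_def)
next
  interpret cring "padic_cauchy_ring p" by (rule padic_cauchy_ring_cring)
  assume "x \<in> padic_null p"
  then show "padic_null p +>\<^bsub>padic_cauchy_ring p\<^esub> x = \<zero>\<^bsub>padic_field p\<^esub>"
    using a_rcos_zero[OF padic_null_ideal] by (simp add: padic_field_def FactRing_def)
qed

theorem padic_field_field: "field (padic_field p)"
proof -
  let ?R = "padic_cauchy_ring p" and ?I = "padic_null p"
  interpret R: cring ?R by (rule padic_cauchy_ring_cring)
  interpret I: ideal ?I ?R by (rule padic_null_ideal)
  interpret Q: cring "padic_field p"
    unfolding padic_field_def by (rule I.quotient_is_cring[OF padic_cauchy_ring_cring])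
  have one: "\<one>\<^bsub>padic_field p\<^esub> = ?I +>\<^bsub>?R\<^esub> (\<lambda>n. 1)"
    by (simp add: padic_field_def FactRing_def padic_cauchy_ring_def)
  show ?thesis
  proof (rule Q.cring_fieldI2)
    have "(\<lambda>n. 1) \<notin> ?I"
      by (auto simp: padic_null_def padic_abs_rat_1 LIMSEQ_const_iff)
    then show "\<zero>\<^bsub>padic_field p\<^esub> \<noteq> \<one>\<^bsub>padic_field p\<^esub>"
      using padic_coset_eq_0[OF padic_cauchy_const, of 1] one by metis
  next
    fix X assume X: "X \<in> carrier (padic_field p)" "X \<noteq> \<zero>\<^bsub>padic_field p\<^esub>"
    then obtain x where x: "padic_cauchy p x" "X = ?I +>\<^bsub>?R\<^esub> x"
      by (auto simp: padic_field_carrier)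
    have nn: "x \<notin> ?I" using X x padic_coset_eq_0 by auto
    let ?y = "\<lambda>n. inverse (x n)"
    have y: "padic_cauchy p ?y" by (rule padic_cauchy_inverse[OF x(1) nn])
    obtain k where "eventually (\<lambda>n. x n \<noteq> 0 \<and> padic_ord_rat p (x n) = k) sequentially"
      by (rule padic_cauchy_nonnull[OF x(1) nn])
    then have "eventually (\<lambda>n. padic_abs_rat p (x n * ?y n - 1) = 0) sequentially"
      by eventually_elim (simp add: padic_abs_rat_0)
    then have xy: "(\<lambda>n. x n * ?y n - 1) \<in> ?I"
      unfolding padic_null_def by (simp add: tendsto_eventually)
    have "X \<otimes>\<^bsub>padic_field p\<^esub> (?I +>\<^bsub>?R\<^esub> ?y) = ?I +>\<^bsub>?R\<^esub> (x \<otimes>\<^bsub>?R\<^esub> ?y)"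
      using I.rcoset_mult_add[of x ?y] x y
      by (simp add: padic_field_def FactRing_def padic_cauchy_ring_def)
    also have "\<dots> = ?I +>\<^bsub>?R\<^esub> (\<lambda>n. 1)"
    proof (rule I.a_repr_independence'[symmetric])
      show "x \<otimes>\<^bsub>?R\<^esub> ?y \<in> ?I +>\<^bsub>?R\<^esub> (\<lambda>n. 1)"
        unfolding padic_coset using xy by (simp add: padic_cauchy_ring_def)
    qed (simp add: padic_cauchy_ring_def padic_cauchy_const)
    finally show "\<exists>Y\<in>carrier (padic_field p). X \<otimes>\<^bsub>padic_field p\<^esub> Y = \<one>\<^bsub>padic_field p\<^esub>"
      using y one padic_field_carrier by metis
  qed
qed

lemma padic_field_minus:
  assumes "padic_cauchy p x" "padic_cauchy p y"
  shows "(padic_null p +>\<^bsub>padic_cauchy_ring p\<^esub> x) \<ominus>\<^bsub>padic_field p\<^esub>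
           (padic_null p +>\<^bsub>padic_cauchy_ring p\<^esub> y) =
         padic_null p +>\<^bsub>padic_cauchy_ring p\<^esub> (\<lambda>n. x n - y n)"
proof -
  let ?R = "padic_cauchy_ring p" and ?I = "padic_null p"
  interpret R: cring ?R by (rule padic_cauchy_ring_cring)
  interpret I: ideal ?I ?R by (rule padic_null_ideal)
  interpret Q: field "padic_field p" by (rule padic_field_field)
  have add: "(?I +>\<^bsub>?R\<^esub> u) \<oplus>\<^bsub>padic_field p\<^esub> (?I +>\<^bsub>?R\<^esub> v) = ?I +>\<^bsub>?R\<^esub> (\<lambda>n. u n + v n)"
    if "padic_cauchy p u" "padic_cauchy p v" for u v
    using I.a_rcos_sum[of u v] that
    by (simp add: padic_field_def FactRing_def padic_cauchy_ring_def)
  have m: "padic_cauchy p (\<lambda>n. - y n)" by (rule padic_cauchy_minus[OF assms(2)])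
  have "\<ominus>\<^bsub>padic_field p\<^esub> (?I +>\<^bsub>?R\<^esub> y) = ?I +>\<^bsub>?R\<^esub> (\<lambda>n. - y n)"
    by (rule Q.minus_equality)
      (use assms m in \<open>auto simp: add padic_coset_eq_0 padic_null_0 padic_cauchy_const padic_field_carrier\<close>)
  then show ?thesis using add[OF assms(1) m] by (simp add: a_minus_def)
qed

lemma padic_ord_eqI:
  assumes X: "X \<in> carrier (padic_field p)" "X \<noteq> \<zero>\<^bsub>padic_field p\<^esub>"
    and x: "x \<in> X" "eventually (\<lambda>n. padic_ord_rat p (x n) = k) sequentially"
  shows "padic_ord p X = k"
proof -
  obtain z where z: "padic_cauchy p z" "X = {y. (\<lambda>n. y n - z n) \<in> padic_null p}"
    "z \<notin> padic_null p"
    using X padic_field_carrier padic_coset_eq_0 padic_coset by metis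
  obtain l where l: "eventually (\<lambda>n. z n \<noteq> 0 \<and> padic_ord_rat p (z n) = l) sequentially"
    by (rule padic_cauchy_nonnull[OF z(1,3)])
  have ev: "eventually (\<lambda>n. padic_ord_rat p (y n) = l) sequentially" if "y \<in> X" for y
  proof -
    have "(\<lambda>n. padic_abs_rat p (y n - z n)) \<longlonglongrightarrow> 0"
      using that z(2) by (simp add: padic_null_def)
    moreover have "0 < real p powi (- l)" using p_gt1 by simp
    ultimately have "eventually (\<lambda>n. padic_abs_rat p (y n - z n) < real p powi (- l)) sequentially"
      by (rule order_tendstoD(2))
    then show ?thesis using l
    proof eventually_elim
      case (elim n)
      then have "padic_abs_rat p (y n - z n) < padic_abs_rat p (z n)"
        by (simp add: padic_abs_rat_def)
      from padic_ord_rat_eqI(2)[OF this] elim show ?case by simp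
    qed
  qed
  have uniq: "i = j" if "eventually (\<lambda>n. padic_ord_rat p (x n) = i) sequentially"
    "eventually (\<lambda>n. padic_ord_rat p (x n) = j) sequentially" for i j
    using eventually_happens[OF eventually_conj[OF that]] by auto
  have "k = l" using uniq x ev by blast
  then show ?thesis unfolding padic_ord_def
    using ev uniq x(1) by (intro the_equality) blast+
qed

lemma padic_abs_tendsto:
  assumes X: "X \<in> carrier (padic_field p)" and x: "x \<in> X"
  shows "(\<lambda>n. padic_abs_rat p (x n)) \<longlonglongrightarrow> padic_abs p X"
proof (cases "X = \<zero>\<^bsub>padic_field p\<^esub>")
  case True
  then show ?thesis using x by (simp add: padic_abs_def padic_field_def FactRing_def padic_null_def)
next
  case False
  obtain z where z: "padic_cauchy p z" "X = padic_null p +>\<^bsub>padic_cauchy_ring p\<^esub> z"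
    using X by (auto simp: padic_field_carrier)
  have d: "(\<lambda>n. x n - z n) \<in> padic_null p" using x z padic_coset by blast
  have xc: "padic_cauchy p x"
    using padic_cauchy_add[OF padic_null_cauchy[OF d] z(1)] by simp
  have xn: "x \<notin> padic_null p"
  proof
    assume "x \<in> padic_null p"
    from padic_null_add[OF this padic_null_minus[OF d]] have "z \<in> padic_null p" by simp
    then show False using False z padic_coset_eq_0 by blast
  qed
  obtain k where k: "eventually (\<lambda>n. x n \<noteq> 0 \<and> padic_ord_rat p (x n) = k) sequentially"
    by (rule padic_cauchy_nonnull[OF xc xn])
  then have "padic_ord p X = k"
    by (intro padic_ord_eqI[OF X False x]) (auto elim: eventually_mono)
  then have "eventually (\<lambda>n. padic_abs_rat p (x n) = padic_abs p X) sequentially"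
    using k by (auto simp: padic_abs_def padic_abs_rat_def False elim!: eventually_mono)
  then show ?thesis by (rule tendsto_eventually)
qed

lemma padic_abs_of_rat:
  "padic_abs p (padic_null p +>\<^bsub>padic_cauchy_ring p\<^esub> (\<lambda>n. q)) = padic_abs_rat p q"
proof -
  let ?X = "padic_null p +>\<^bsub>padic_cauchy_ring p\<^esub> (\<lambda>n. q)"
  have "(\<lambda>n. padic_abs_rat p q) \<longlonglongrightarrow> padic_abs p ?X"
    using padic_abs_tendsto[of ?X "\<lambda>n. q"] padic_cauchy_const padic_null_0
    by (auto simp: padic_field_carrier padic_coset)
  then show ?thesis by (simp add: LIMSEQ_const_iff)
qed

end

end

theory Submission
  imports Defs "HOL-Algebra.Multiplicative_Group"
begin

text \<open>
  The distances occurring in \<open>\<rat>\<^sub>p\<close> are exactly \<open>0\<close> and the integer powers of \<open>p\<close>, so only the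
  values of \<open>f\<close> there matter.  The conditions on \<open>f(0)\<close> and \<open>f(p^n)\<close> say that \<open>f\<close> is monotone on this set, vanishes
  at \<open>0\<close> and is positive elsewhere.  A map with these properties turns any ultrametric into an
  ultrametric (\<open>ultrametric_on_compose\<close>), because monotone maps commute with \<open>max\<close>.

  Conversely, \<open>p^n\<close> is the distance of \<open>0\<close> and \<open>p^(-n)\<close>, which gives \<open>f(p^n) > 0\<close>.  The point
  \<open>p^(-n-1)\<close> has distance \<open>p^(n+1)\<close> from both of them: the three points form an isosceles triangle
  with base \<open>p^n\<close> and legs \<open>p^(n+1)\<close> (\<open>padic_isosceles\<close>).  The strong triangle inequality for
  \<open>f \<circ> d\<^sub>p\<close>, applied to its base, is \<open>f(p^n) \<le> f(p^(n+1))\<close>.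
\<close>

lemma ultrametric_on_compose:
  assumes d: "ultrametric_on M d"
    and V: "\<And>x y. x \<in> M \<Longrightarrow> y \<in> M \<Longrightarrow> d x y \<in> V"
    and mono: "mono_on V f"
    and pos: "\<And>v. v \<in> V \<Longrightarrow> 0 \<le> f v"
    and zero: "\<And>v. v \<in> V \<Longrightarrow> f v = 0 \<longleftrightarrow> v = 0"
  shows "ultrametric_on M (\<lambda>x y. f (d x y))"
  unfolding ultrametric_on_iff
proof (intro conjI ballI)
  fix x y assume xy: "x \<in> M" "y \<in> M"
  have "d x y = d y x" "d x y = 0 \<longleftrightarrow> x = y"
    using d xy unfolding ultrametric_on_iff by blast+
  then show "0 \<le> f (d x y)" "f (d x y) = f (d y x)" "f (d x y) = 0 \<longleftrightarrow> x = y"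
    using pos zero V xy by auto
next
  fix x y z assume xyz: "x \<in> M" "y \<in> M" "z \<in> M"
  have "d x y \<le> max (d x z) (d z y)"
    using d xyz unfolding ultrametric_on_iff by blast
  then have "d x y \<le> d x z \<or> d x y \<le> d z y" by (simp add: le_max_iff_disj)
  then show "f (d x y) \<le> max (f (d x z)) (f (d z y))"
    unfolding le_max_iff_disj using mono V xyz by (meson mono_onD)
qed

lemma padic_dist_tendsto:
  assumes p: "prime p" and "padic_cauchy p x" "padic_cauchy p y"
  shows "(\<lambda>n. padic_abs_rat p (x n - y n)) \<longlonglongrightarrow>
    padic_dist p (padic_null p +>\<^bsub>padic_cauchy_ring p\<^esub> x) (padic_null p +>\<^bsub>padic_cauchy_ring p\<^esub> y)"
proof -
  have "padic_cauchy p (\<lambda>n. x n - y n)"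
    using padic_cauchy_add[OF p assms(2) padic_cauchy_minus[OF p assms(3)]] by simp
  then show ?thesis
    unfolding padic_dist_def padic_field_minus[OF assms]
    by (intro padic_abs_tendsto[OF p])
      (auto simp: padic_field_carrier[OF p] padic_coset[OF p] padic_null_0[OF p])
qed

lemma padic_dist_range: "padic_dist p X Y \<in> insert 0 (range (\<lambda>n::int. real p powi n))"
  by (simp add: padic_dist_def padic_abs_def)

text \<open>
  Symmetry and the strong triangle inequality pass to the limit from the absolute value on the
  rationals.  Definiteness does not (a limit of positive numbers may vanish) and comes from the
  field structure instead.
\<close>

lemma ultrametric_on_padic_dist:
  assumes p: "prime p"
  shows "ultrametric_on (carrier (padic_field p)) (padic_dist p)"
  unfolding ultrametric_on_iff
proof (intro conjI ballI)
  interpret Q: field "padic_field p" by (rule padic_field_field[OF p])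
  fix X Y assume X: "X \<in> carrier (padic_field p)" and Y: "Y \<in> carrier (padic_field p)"
  obtain x where x: "padic_cauchy p x" "X = padic_null p +>\<^bsub>padic_cauchy_ring p\<^esub> x"
    using X by (auto simp: padic_field_carrier[OF p])
  obtain y where y: "padic_cauchy p y" "Y = padic_null p +>\<^bsub>padic_cauchy_ring p\<^esub> y"
    using Y by (auto simp: padic_field_carrier[OF p])
  show "0 \<le> padic_dist p X Y"
    by (simp add: padic_dist_def padic_abs_def)
  have "(\<lambda>n. padic_abs_rat p (x n - y n)) \<longlonglongrightarrow> padic_dist p Y X"
    using padic_dist_tendsto[OF p y(1) x(1)]
    by (simp add: padic_abs_rat_diff_commute[OF p, of "y _"] x(2) y(2))
  then show "padic_dist p X Y = padic_dist p Y X"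
    using padic_dist_tendsto[OF p x(1) y(1)] unfolding x(2) y(2)
    by (metis LIMSEQ_unique)
  have "padic_dist p X Y = 0 \<longleftrightarrow> X \<ominus>\<^bsub>padic_field p\<^esub> Y = \<zero>\<^bsub>padic_field p\<^esub>"
    using p_gt1[OF p] by (simp add: padic_dist_def padic_abs_def)
  then show "padic_dist p X Y = 0 \<longleftrightarrow> X = Y"
    using X Y by (simp add: Q.r_right_minus_eq)
next
  fix X Y Z assume "X \<in> carrier (padic_field p)" "Y \<in> carrier (padic_field p)"
    "Z \<in> carrier (padic_field p)"
  then obtain x y z where x: "padic_cauchy p x" "X = padic_null p +>\<^bsub>padic_cauchy_ring p\<^esub> x"
    and y: "padic_cauchy p y" "Y = padic_null p +>\<^bsub>padic_cauchy_ring p\<^esub> y"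
    and z: "padic_cauchy p z" "Z = padic_null p +>\<^bsub>padic_cauchy_ring p\<^esub> z"
    by (auto simp: padic_field_carrier[OF p])
  have "padic_abs_rat p (x n - y n) \<le>
      max (padic_abs_rat p (x n - z n)) (padic_abs_rat p (z n - y n))" for n
    using padic_abs_rat_add[OF p, of "x n - z n" "z n - y n"] by simp
  then show "padic_dist p X Y \<le> max (padic_dist p X Z) (padic_dist p Z Y)"
    unfolding x(2) y(2) z(2)
    using padic_dist_tendsto[OF p x(1) y(1)]
      tendsto_max[OF padic_dist_tendsto[OF p x(1) z(1)] padic_dist_tendsto[OF p z(1) y(1)]]
    by (blast intro: LIMSEQ_le)
qed

lemma padic_abs_rat_prime_powi:
  assumes p: "prime p"
  shows "padic_abs_rat p (of_nat p powi k) = real p powi (- k)"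
proof -
  have p0: "p \<noteq> 0" using p by auto
  have "(of_nat p powi k :: rat) = of_int (int p ^ nat k) / of_int (int p ^ nat (- k))"
    by (cases "k \<ge> 0") (auto simp: power_int_def field_simps)
  moreover have "multiplicity (int p) (int p ^ n) = n" for n
    using p p0 by (intro multiplicity_same_power) auto
  ultimately have "padic_ord_rat p (of_nat p powi k) = k"
    using padic_ord_rat_divide[OF p, of "int p ^ nat k" "int p ^ nat (- k)"] p0 by simp
  then show ?thesis using p0 by (simp add: padic_abs_rat_def)
qed

lemma padic_dist_of_rat:
  assumes p: "prime p"
  shows "padic_dist p (padic_null p +>\<^bsub>padic_cauchy_ring p\<^esub> (\<lambda>n. q))
    (padic_null p +>\<^bsub>padic_cauchy_ring p\<^esub> (\<lambda>n. r)) = padic_abs_rat p (q - r)"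
  by (simp add: padic_dist_def padic_field_minus[OF p] padic_cauchy_const[OF p]
      padic_abs_of_rat[OF p])

text \<open>
  The vertices are \<open>0\<close>, \<open>p^(-n)\<close> and \<open>p^(-n-1)\<close>: the last one is strictly
  larger in absolute value than the second, hence dominates in their difference.
\<close>

lemma padic_isosceles:
  fixes n :: int
  assumes p: "prime p"
  obtains X Y Z where "X \<in> carrier (padic_field p)" "Y \<in> carrier (padic_field p)"
    "Z \<in> carrier (padic_field p)" "padic_dist p X Y = real p powi n"
    "padic_dist p X Z = real p powi (n + 1)" "padic_dist p Z Y = real p powi (n + 1)"
proof -
  let ?c = "\<lambda>q. padic_null p +>\<^bsub>padic_cauchy_ring p\<^esub> (\<lambda>n. q)"
  let ?y = "of_nat p powi (- n) :: rat" and ?z = "of_nat p powi (- (n + 1)) :: rat"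
  have abs_y: "padic_abs_rat p ?y = real p powi n"
    and abs_z: "padic_abs_rat p ?z = real p powi (n + 1)"
    by (simp_all only: padic_abs_rat_prime_powi[OF p] minus_minus)
  have "padic_abs_rat p (?z - ?y - ?z) < padic_abs_rat p ?z"
    using p_gt1[OF p] abs_y abs_z
    by (simp add: padic_abs_rat_minus[OF p] power_int_strict_increasing)
  then have abs_zy: "padic_abs_rat p (?z - ?y) = real p powi (n + 1)"
    using padic_abs_rat_eqI[OF p] abs_z by metis
  show ?thesis
  proof (rule that)
    show "?c 0 \<in> carrier (padic_field p)" "?c ?y \<in> carrier (padic_field p)"
      "?c ?z \<in> carrier (padic_field p)"
      using padic_cauchy_const[OF p] padic_field_carrier[OF p] by blast+
    show "padic_dist p (?c 0) (?c ?y) = real p powi n"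
      "padic_dist p (?c 0) (?c ?z) = real p powi (n + 1)"
      unfolding padic_dist_of_rat[OF p] diff_0 padic_abs_rat_minus[OF p]
      by (fact abs_y abs_z)+
    show "padic_dist p (?c ?z) (?c ?y) = real p powi (n + 1)"
      unfolding padic_dist_of_rat[OF p] by (fact abs_zy)
  qed
qed

lemma mono_on_zero_and_powers:
  fixes b :: real and f :: "real \<Rightarrow> real"
  assumes b: "b > 1" and f0: "f 0 = 0"
    and f: "\<And>n::int. 0 \<le> f (b powi n)" "\<And>n::int. f (b powi n) \<le> f (b powi (n + 1))"
  shows "mono_on (insert 0 (range (\<lambda>n::int. b powi n))) f"
proof (rule mono_onI)
  have pos: "0 < b powi n" for n :: int using b by simp
  have step: "f (b powi m) \<le> f (b powi n)" if "m \<le> n" for m n :: int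
    using that by (induction n rule: int_ge_induct) (auto intro: order_trans f(2))
  fix u v assume "u \<in> insert 0 (range (\<lambda>n::int. b powi n))"
    "v \<in> insert 0 (range (\<lambda>n::int. b powi n))" and uv: "u \<le> v"
  then consider "u = 0" "v = 0" | n :: int where "u = 0" "v = b powi n"
    | m :: int where "u = b powi m" "v = 0" | m n :: int where "u = b powi m" "v = b powi n"
    by blast
  then show "f u \<le> f v"
  proof cases
    case (3 m)
    then show ?thesis using uv pos[of m] by simp
  next
    case (4 m n)
    have "m \<le> n"
      using uv 4 b power_int_strict_increasing[of n m b] by (meson leD leI)
    then show ?thesis using step 4 by simp
  qed (use f0 f(1) in auto)
qed

theorem proposition4p7:
  fixes p :: nat and f :: "real \<Rightarrow> real"
  assumes "prime p"
    and "f \<in> {0..} \<rightarrow> {0..}"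
  shows "(f 0 = 0 \<and>
          (\<forall>n::int. 0 < f (real p powi n) \<and> f (real p powi n) \<le> f (real p powi (n + 1))))
         \<longleftrightarrow> padic_ultrametric_preserving p f"
proof
  let ?V = "insert 0 (range (\<lambda>n::int. real p powi n))"
  assume f: "f 0 = 0 \<and>
    (\<forall>n::int. 0 < f (real p powi n) \<and> f (real p powi n) \<le> f (real p powi (n + 1)))"
  have nz: "real p powi n \<noteq> 0" "f (real p powi n) \<noteq> 0" "0 \<le> f (real p powi n)" for n :: int
    using p_gt1[OF assms(1)] f by (auto simp: less_imp_le order_less_imp_not_eq2)
  show "padic_ultrametric_preserving p f"
    unfolding padic_ultrametric_preserving_def
  proof (rule ultrametric_on_compose[OF ultrametric_on_padic_dist[OF assms(1)] padic_dist_range])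
    show "mono_on ?V f"
      using f p_gt1[OF assms(1)] by (intro mono_on_zero_and_powers) (auto simp: less_imp_le)
    show "0 \<le> f v" "f v = 0 \<longleftrightarrow> v = 0" if "v \<in> ?V" for v
      using that f nz by auto
  qed
next
  let ?Q = "carrier (padic_field p)"
  assume "padic_ultrametric_preserving p f"
  then have um: "ultrametric_on ?Q (\<lambda>x y. f (padic_dist p x y))"
    by (simp add: padic_ultrametric_preserving_def)
  have nonneg: "0 \<le> f (padic_dist p X Y)"
    and zero: "f (padic_dist p X Y) = 0 \<longleftrightarrow> X = Y" if "X \<in> ?Q" "Y \<in> ?Q" for X Y
    using um that unfolding ultrametric_on_iff by blast+
  have tri: "f (padic_dist p X Y) \<le> max (f (padic_dist p X Z)) (f (padic_dist p Z Y))"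
    if "X \<in> ?Q" "Y \<in> ?Q" "Z \<in> ?Q" for X Y Z
    using um that unfolding ultrametric_on_iff by blast
  have dist_0: "padic_dist p X Y = 0 \<longleftrightarrow> X = Y" if "X \<in> ?Q" "Y \<in> ?Q" for X Y
    using ultrametric_on_padic_dist[OF assms(1)] that unfolding ultrametric_on_iff by blast
  have "0 < f (real p powi n) \<and> f (real p powi n) \<le> f (real p powi (n + 1))" for n :: int
  proof -
    obtain X Y Z where XYZ: "X \<in> ?Q" "Y \<in> ?Q" "Z \<in> ?Q"
      and d: "padic_dist p X Y = real p powi n" "padic_dist p X Z = real p powi (n + 1)"
        "padic_dist p Z Y = real p powi (n + 1)"
      by (rule padic_isosceles[OF assms(1)])
    have "padic_dist p X Y \<noteq> 0" using d(1) p_gt1[OF assms(1)] by simp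
    then have "0 < f (padic_dist p X Y)"
      using nonneg zero dist_0 XYZ by (metis order_le_less)
    then show ?thesis using tri[OF XYZ] by (simp add: d)
  qed
  moreover have "f 0 = 0"
  proof -
    obtain X where "X \<in> ?Q" by (rule padic_isosceles[OF assms(1)])
    then show ?thesis using zero[of X X] dist_0[of X X] by simp
  qed
  ultimately show "f 0 = 0 \<and>
    (\<forall>n::int. 0 < f (real p powi n) \<and> f (real p powi n) \<le> f (real p powi (n + 1)))"
    by blast
qed

end
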